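(* Let $p$ be a prime. For every $m\ge 2$, $$f_{m,p}(X)=\sum_{\varepsilon\in\Omega(m-2)}X^{(-1)^{m-1}\|\varepsilon\|_{-p}}.$$
   Context: Let $\mathbb{F}$ be an algebraic closure of $\mathbb{F}_p$. For $x,y\in\mathbb{F}$ and integers $i,j\ge0$ write $[i,j]:=x^{p^i}y^{p^j}-x^{p^j}y^{p^i}$; for $x,y$ linearly independent over $\mathbb{F}_p$ let $\nu(x,y):=-\dfrac{[0,2][1,3]}{[0,1][2,3]}$. For $m\ge1$ let $\mathcal{Z}(m)=\{\nu(x,y): x,y\in\mathbb{F}_{p^m}\text{ linearly independent over }\mathbb{F}_p\}$, $\mathcal{Z}^\circ(m)=\mathcal{Z}(m)\setminus\{0\}$, $f_{m,p}(X):=\prod_{z\in\mathcal{Z}^\circ(m)}(X-z)$. For $n\ge1$, $\Omega(n)$ is the set of down-up (zigzag) sequences of length $n$: zero-one sequences $(\varepsilon_{n-1},\varepsilon_{n-2},\dots,\varepsilon_0)$ with $\varepsilon_{n-1}\ge\varepsilon_{n-2}\le\varepsilon_{n-3}\ge\varepsilon_{n-4}\le\cdots\varepsilon_0$ (alternating inequalities starting with $\ge$). By convention $\Omega(0)$ consists of a single sequence whose value is $0$. For a sequence $V=(v_{n-1},\dots,v_0)$ and integer $b$, $\|V\|_b:=\sum_{i=0}^{n-1}v_ib^i$. *)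

theory Defs
  imports "HOL-Computational_Algebra.Computational_Algebra"
begin

text \<open>
  In a field of characteristic \<open>p\<close> the set \<open>\<int>\<close> is the image of the integers, that is, the prime
  field \<open>\<F>\<^sub>p\<close>.  So the last conjunct says that the extension is algebraic over \<open>\<F>\<^sub>p\<close>; that the
  field is algebraically closed is part of the sort of \<open>'a\<close>.
\<close>

definition is_alg_closure_Fp :: "nat \<Rightarrow> 'a :: alg_closed_field itself \<Rightarrow> bool" where
  "is_alg_closure_Fp p T \<longleftrightarrow>
     CHAR('a) = p \<and>
     (\<forall>x::'a. \<exists>q. q \<noteq> 0 \<and> (\<forall>i. coeff q i \<in> \<int>) \<and> poly q x = 0)"

definition lin_indep_Fp :: "'a :: field \<Rightarrow> 'a \<Rightarrow> bool" where
  "lin_indep_Fp x y \<longleftrightarrow> (\<forall>a\<in>\<int>. \<forall>b\<in>\<int>. a * x + b * y = 0 \<longrightarrow> a = 0 \<and> b = 0)"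

text \<open>
  The subfield \<open>\<F>\<^bsub>p^m\<^esub>\<close> of an algebraic closure of \<open>\<F>\<^sub>p\<close>; see \<open>GF_subfield\<close>, \<open>card_GF\<close> and
  \<open>GF_unique\<close> below.
\<close>

definition GF :: "nat \<Rightarrow> nat \<Rightarrow> 'a :: field set" where
  "GF p m = {x. x ^ (p ^ m) = x}"

lemma GF_subfield:
  assumes "prime p" "CHAR('a :: field) = p"
  shows "0 \<in> (GF p m :: 'a set)" "1 \<in> (GF p m :: 'a set)"
    "\<And>x y :: 'a. x \<in> GF p m \<Longrightarrow> y \<in> GF p m \<Longrightarrow> x + y \<in> GF p m"
    "\<And>x y :: 'a. x \<in> GF p m \<Longrightarrow> y \<in> GF p m \<Longrightarrow> x - y \<in> GF p m"
    "\<And>x y :: 'a. x \<in> GF p m \<Longrightarrow> y \<in> GF p m \<Longrightarrow> x * y \<in> GF p m"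
    "\<And>x y :: 'a. x \<in> GF p m \<Longrightarrow> y \<in> GF p m \<Longrightarrow> x / y \<in> GF p m"
proof -
  have pr: "prime CHAR('a)" using assms by simp
  have add: "(x + y) ^ (p ^ m) = x ^ (p ^ m) + y ^ (p ^ m)" for x y :: 'a
    by (rule freshmans_dream'[OF pr]) (simp add: assms)
  show "0 \<in> (GF p m :: 'a set)" "1 \<in> (GF p m :: 'a set)"
    using assms(1) by (auto simp: GF_def power_0_left prime_gt_0_nat)
  show "x + y \<in> GF p m" if "x \<in> GF p m" "y \<in> GF p m" for x y :: 'a
    using that by (simp add: GF_def add)
  show "x - y \<in> GF p m" if "x \<in> GF p m" "y \<in> GF p m" for x y :: 'a
    using that add[of "x - y" y] by (simp add: GF_def eq_diff_eq)
  show "x * y \<in> GF p m" if "x \<in> GF p m" "y \<in> GF p m" for x y :: 'a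
    using that by (simp add: GF_def power_mult_distrib)
  show "x / y \<in> GF p m" if "x \<in> GF p m" "y \<in> GF p m" for x y :: 'a
    using that by (simp add: GF_def power_divide)
qed

lemma card_GF:
  assumes "prime p" "CHAR('a :: alg_closed_field) = p" "m \<ge> 1"
  shows "card (GF p m :: 'a set) = p ^ m"
proof -
  define q :: "'a poly" where "q = monom 1 (p ^ m) - monom 1 1"
  have gt: "p ^ m > 1"
    using prime_gt_1_nat[OF assms(1)] assms(3) by (intro one_less_power) auto
  have deg: "degree q = p ^ m"
    unfolding q_def diff_conv_add_uminus
    using gt by (subst degree_add_eq_left) (auto simp: degree_monom_eq)
  have "q \<noteq> 0" using deg gt by (metis degree_0 not_one_less_zero)
  have "of_nat (p ^ m) = (0 :: 'a)"
    using assms by (simp add: of_nat_eq_0_iff_char_dvd)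
  hence pd: "pderiv q = -1"
    unfolding q_def by (simp add: pderiv_diff pderiv_monom monom_eq_1)
  obtain A where A: "size A = degree q" "q = smult (lead_coeff q) (\<Prod>x\<in>#A. [:-x, 1:])"
    using alg_closed_imp_factorization[OF \<open>q \<noteq> 0\<close>] by blast
  have le1: "count A x \<le> 1" for x
  proof (rule ccontr)
    assume "\<not> count A x \<le> 1"
    hence "{#x, x#} \<subseteq># A" by (auto simp: subseteq_mset_def)
    then obtain B where B: "A = {#x, x#} + B" by (auto simp: subset_mset.le_iff_add)
    define r where "r = smult (lead_coeff q) (\<Prod>x\<in>#B. [:-x, 1:])"
    have "q = [:-x, 1:] * ([:-x, 1:] * r)"
      by (subst A(2), subst B) (simp add: r_def)
    hence "poly (pderiv q) x = 0" by (simp only: pderiv_mult) (simp add: pderiv_pCons)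
    thus False by (simp add: pd)
  qed
  have "set_mset A = {x. poly q x = 0}"
  proof -
    have "poly q x = 0 \<longleftrightarrow> x \<in># A" for x
      by (subst A(2)) (use \<open>q \<noteq> 0\<close> in \<open>auto simp: poly_prod_mset prod_mset_zero_iff\<close>)
    thus ?thesis by auto
  qed
  also have "\<dots> = GF p m"
    by (auto simp: q_def GF_def poly_monom)
  finally have eq: "GF p m = set_mset A" ..
  have "card (set_mset A) = (\<Sum>x\<in>set_mset A. count A x)"
    using le1 by (subst card_eq_sum, intro sum.cong refl)
      (metis One_nat_def count_greater_eq_one_iff le_antisym)
  also have "\<dots> = p ^ m" using A(1) deg by (simp add: size_multiset_overloaded_eq)
  finally show ?thesis unfolding eq .
qed

lemma GF_unique:
  fixes K :: "'a :: alg_closed_field set"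
  assumes "prime p" "CHAR('a) = p" "m \<ge> 1" "card K = p ^ m" "0 \<in> K"
    and mult: "\<And>x y. x \<in> K \<Longrightarrow> y \<in> K \<Longrightarrow> x * y \<in> K"
  shows "K = GF p m"
proof -
  have pos: "p ^ m > 0" using assms(1) by (simp add: prime_gt_0_nat)
  hence fin: "finite K" using assms(4) by (intro card_ge_0_finite) simp
  have "x ^ (p ^ m) = x" if x: "x \<in> K" for x
  proof (cases "x = 0")
    case False
    have "(\<lambda>y. x * y) ` (K - {0}) = K - {0}"
      by (rule card_subset_eq)
         (use fin x False mult in \<open>auto simp: card_image inj_on_def\<close>)
    hence "(\<Prod>y\<in>K - {0}. y) = (\<Prod>y\<in>(\<lambda>y. x * y) ` (K - {0}). y)" by simp
    also have "\<dots> = x ^ card (K - {0}) * (\<Prod>y\<in>K - {0}. y)"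
      using False by (subst prod.reindex) (auto simp: inj_on_def prod.distrib)
    finally have "x ^ card (K - {0}) = 1" using fin by auto
    moreover have "p ^ m = Suc (card (K - {0}))"
      using assms(4,5) fin pos by (simp add: card_Diff_singleton)
    ultimately show ?thesis by simp
  qed (use pos in \<open>simp add: power_0_left\<close>)
  hence "K \<subseteq> GF p m" by (auto simp: GF_def)
  moreover have "card (GF p m :: 'a set) = p ^ m" by (rule card_GF) (use assms in auto)
  ultimately show ?thesis
    using assms(4) pos by (intro card_subset_eq) (auto intro: card_ge_0_finite)
qed

definition bracket :: "nat \<Rightarrow> 'a :: field \<Rightarrow> 'a \<Rightarrow> nat \<Rightarrow> nat \<Rightarrow> 'a" where
  "bracket p x y i j = x ^ (p ^ i) * y ^ (p ^ j) - x ^ (p ^ j) * y ^ (p ^ i)"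

definition nu :: "nat \<Rightarrow> 'a :: field \<Rightarrow> 'a \<Rightarrow> 'a" where
  "nu p x y = - ((bracket p x y 0 2 * bracket p x y 1 3) /
                 (bracket p x y 0 1 * bracket p x y 2 3))"

definition Z_set :: "nat \<Rightarrow> nat \<Rightarrow> 'a :: field set" where
  "Z_set p m = {nu p x y | x y. x \<in> GF p m \<and> y \<in> GF p m \<and> lin_indep_Fp x y}"

definition Z_circ :: "nat \<Rightarrow> nat \<Rightarrow> 'a :: field set" where
  "Z_circ p m = Z_set p m - {0}"

definition f_poly :: "nat \<Rightarrow> nat \<Rightarrow> 'a :: field poly" where
  "f_poly p m = (\<Prod>z\<in>Z_circ p m. [:- z, 1:])"

text \<open>
  A sequence \<open>(v\<^bsub>n-1\<^esub>, \<dots>, v\<^sub>0)\<close> is the list with head \<open>v\<^bsub>n-1\<^esub>\<close>, so \<open>v\<^sub>i\<close> is \<open>rev v ! i\<close>,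
  and list position \<open>k\<close> carries the \<open>(k+1)\<close>-st inequality of the zigzag.
\<close>

definition Omega :: "nat \<Rightarrow> int list set" where
  "Omega n = {e. length e = n \<and> set e \<subseteq> {0, 1} \<and>
     (\<forall>k. Suc k < n \<longrightarrow> (if even k then e ! k \<ge> e ! Suc k else e ! k \<le> e ! Suc k))}"

definition seq_value :: "int \<Rightarrow> int list \<Rightarrow> int" where
  "seq_value b v = (\<Sum>i<length v. rev v ! i * b ^ i)"

text \<open>The exponents in the theorem are nonnegative (\<open>exponent_nonneg\<close> below), so applying \<open>nat\<close> to them loses nothing.\<close>

lemma seq_value_Cons: "seq_value b (a # v) = a * b ^ length v + seq_value b v"
  unfolding seq_value_def by (simp add: nth_append)

lemma Omega_Cons_Cons:
  assumes "a # c # v \<in> Omega (Suc (Suc n))"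
  shows "v \<in> Omega n" "(a, c) \<in> {(0,0), (1,0), (1,1)}"
proof -
  have k: "\<And>k. Suc k < Suc (Suc n) \<Longrightarrow> (if even k then (a # c # v) ! k \<ge> (a # c # v) ! Suc k
            else (a # c # v) ! k \<le> (a # c # v) ! Suc k)"
    and v: "length v = n" "set v \<subseteq> {0,1}" "a \<in> {0,1}" "c \<in> {0,1}"
    using assms unfolding Omega_def by auto
  show "(a, c) \<in> {(0,0), (1,0), (1,1)}"
    using k[of 0] v by auto
  have "if even k then v ! k \<ge> v ! Suc k else v ! k \<le> v ! Suc k" if "Suc k < n" for k
    using k[of "Suc (Suc k)"] that by (simp split: if_splits)
  thus "v \<in> Omega n" using v unfolding Omega_def by auto
qed

lemma exponent_nonneg:
  assumes "e \<in> Omega n" "p \<ge> 1"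
  shows "0 \<le> (-1) ^ Suc n * seq_value (- int p) e"
  using assms(1)
proof (induction n arbitrary: e rule: induct_nat_012)
  case 0
  thus ?case by (simp add: Omega_def seq_value_def)
next
  case 1
  then obtain a where "e = [a]" "a \<in> {0,1}"
    by (auto simp: Omega_def length_Suc_conv)
  thus ?case by (auto simp: seq_value_def)
next
  case (ge2 n)
  then obtain a c v where e: "e = a # c # v"
    by (auto simp: Omega_def length_Suc_conv)
  from ge2.prems have v: "v \<in> Omega n" and ac: "(a, c) \<in> {(0,0), (1,0), (1,1)}"
    unfolding e by (auto dest: Omega_Cons_Cons)
  have len: "length v = n" using v by (simp add: Omega_def)
  have "(-1) ^ Suc (Suc (Suc n)) * seq_value (- int p) e =
        (a * int p - c) * int p ^ n + (-1) ^ Suc n * seq_value (- int p) v"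
    unfolding e seq_value_Cons
    by (simp add: len power_minus[of "int p"] algebra_simps flip: power_add)
  moreover have "(a * int p - c) * int p ^ n \<ge> 0"
    using ac assms(2) by auto
  ultimately show ?case using ge2.IH(1)[OF v] by simp
qed

end

theory Submission
  imports Defs
begin

text \<open>
  Since \<open>[0,m]\<close> vanishes on \<open>\<F>\<^bsub>p^m\<^esub>\<close> and satisfies a three-term recurrence in \<open>m\<close> (a Pluecker
  relation), it equals, up to a nonzero factor, the value at \<open>\<nu>(x,y)\<close> of a polynomial \<open>H\<^sub>m\<close> defined
  by \<open>H\<^bsub>m+2\<^esub> = X\<^bsup>d(m)\<^esup> H\<^bsub>m+1\<^esub> + H\<^sub>m\<close> with \<open>d(m) + d(m+1) = p\<^bsup>m\<^esup>\<close>.  Every nonzero \<open>z\<close> has the form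
  \<open>\<nu>(t,1)\<close>, so the nonzero values of \<open>\<nu>\<close> on \<open>\<F>\<^bsub>p^m\<^esub>\<close> are exactly the roots of \<open>H\<^sub>m\<close>.  The roots are
  simple because the derivative of \<open>H\<^sub>m\<close> or of \<open>X H\<^sub>m\<close> (according to the parity of \<open>m\<close>) is the \<open>p\<close>-th
  power of \<open>H\<^bsub>m-1\<^esub>\<close>, which has no root in common with \<open>H\<^sub>m\<close>.  Finally, a zigzag sequence starting with
  0 continues with another 0 and an arbitrary zigzag sequence, and one starting with 1 continues
  with the complement of a zigzag sequence; so the generating polynomial of the exponents satisfies
  the same recurrence.
\<close>

section \<open>Exponents of the recurrence: alternating sums of powers of \<open>p\<close>\<close>

fun zigzag_exp :: "nat \<Rightarrow> nat \<Rightarrow> nat" where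
  "zigzag_exp p 0 = 0"
| "zigzag_exp p (Suc n) = p ^ n - zigzag_exp p n"

text \<open>Guarantees that the natural subtraction defining \<open>zigzag_exp\<close> never
  truncates.\<close>

lemma zigzag_exp_le: "p \<ge> 1 \<Longrightarrow> zigzag_exp p n \<le> p ^ n"
proof (induction n)
  case (Suc n)
  have "p ^ n \<le> p ^ Suc n" using Suc.prems by (intro power_increasing) auto
  thus ?case unfolding zigzag_exp.simps by linarith
qed simp

lemma zigzag_exp_add: "p \<ge> 1 \<Longrightarrow> zigzag_exp p n + zigzag_exp p (Suc n) = p ^ n"
  using zigzag_exp_le[of p n] by simp

lemma zigzag_exp_pos:
  assumes "p > 1"
  shows "zigzag_exp p (Suc n) > 0"
proof (cases n)
  case (Suc k)
  have "zigzag_exp p n \<le> p ^ k" by (simp add: Suc)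
  also have "\<dots> < p ^ n" using assms by (simp add: Suc)
  finally show ?thesis by simp
qed simp

declare zigzag_exp.simps(2) [simp del]

text \<open>Up to sign, the exponent is the value in base \<open>-p\<close> of the all-ones
  sequence, which appears when a zigzag sequence is complemented.\<close>

lemma int_zigzag_exp_Suc:
  assumes "p \<ge> 1"
  shows "int (zigzag_exp p (Suc n)) = (-1) ^ n * (\<Sum>i\<le>n. (- int p) ^ i)"
proof (induction n)
  case (Suc n)
  have "int (zigzag_exp p (Suc (Suc n))) = int p ^ Suc n - int (zigzag_exp p (Suc n))"
    using zigzag_exp_add[OF assms, of "Suc n"] by (metis add_diff_cancel_left' of_nat_add of_nat_power)
  also have "int p ^ Suc n = (-1) ^ Suc n * (- int p) ^ Suc n"
    by (simp only: mult_minus_left mult_1 minus_minus flip: power_mult_distrib)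
  also have "\<dots> - int (zigzag_exp p (Suc n)) = (-1) ^ Suc n * (\<Sum>i\<le>Suc n. (- int p) ^ i)"
    unfolding Suc.IH sum.atMost_Suc by (simp add: distrib_left right_diff_distrib)
  finally show ?case .
qed (simp add: zigzag_exp.simps)

text \<open>Multiplying an alternating sum by \<open>p\<close> shifts it and leaves only the
  constant term 1 or -1. Hence each power of X in the recurrence is, up to one factor X, a
  \<open>p\<close>-th power, invisible to the derivative.\<close>

lemma zigzag_exp_parity:
  assumes "p \<ge> 1"
  shows "zigzag_exp p (2 * k + 1) = 1 + p * zigzag_exp p (2 * k)"
    and "zigzag_exp p (2 * k + 2) + 1 = p * zigzag_exp p (2 * k + 1)"
proof -
  have "zigzag_exp p (2 * k + 1) = 1 + p * zigzag_exp p (2 * k) \<and>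
        zigzag_exp p (2 * k + 2) + 1 = p * zigzag_exp p (2 * k + 1)"
  proof (induction k)
    case 0
    show ?case using assms by (simp add: zigzag_exp.simps eval_nat_numeral)
  next
    case (Suc k)
    note add = zigzag_exp_add[OF assms]
    have IH: "zigzag_exp p (2 * k + 1) = 1 + p * zigzag_exp p (2 * k)"
        "zigzag_exp p (2 * k + 2) + 1 = p * zigzag_exp p (2 * k + 1)" using Suc.IH by auto
    have 1: "zigzag_exp p (2 * k + 2) + zigzag_exp p (2 * k + 3) = p * p ^ (2 * k + 1)"
      and 2: "zigzag_exp p (2 * k + 1) + zigzag_exp p (2 * k + 2) = p ^ (2 * k + 1)"
      and 3: "zigzag_exp p (2 * k + 3) + zigzag_exp p (2 * k + 4) = p * p ^ (2 * k + 2)"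
      and 4: "zigzag_exp p (2 * k + 2) + zigzag_exp p (2 * k + 3) = p ^ (2 * k + 2)"
      using add[of "2 * k + 2"] add[of "2 * k + 1"] add[of "2 * k + 3"]
      by (simp_all add: eval_nat_numeral)
    have a: "zigzag_exp p (2 * k + 3) = 1 + p * zigzag_exp p (2 * k + 2)"
      using IH(2) 1 unfolding 2[symmetric] distrib_left by linarith
    have b: "zigzag_exp p (2 * k + 4) + 1 = p * zigzag_exp p (2 * k + 3)"
      using a 3 unfolding 4[symmetric] distrib_left by linarith
    show ?case using a b by (simp add: eval_nat_numeral)
  qed
  thus "zigzag_exp p (2 * k + 1) = 1 + p * zigzag_exp p (2 * k)"
    "zigzag_exp p (2 * k + 2) + 1 = p * zigzag_exp p (2 * k + 1)" by auto
qed

section \<open>Generating polynomials of zigzag sequences\<close>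

fun zigzag_poly :: "nat \<Rightarrow> nat \<Rightarrow> 'a :: comm_ring_1 poly" where
  "zigzag_poly p 0 = 0"
| "zigzag_poly p (Suc 0) = 1"
| "zigzag_poly p (Suc (Suc m)) = monom 1 (zigzag_exp p m) * zigzag_poly p (Suc m) + zigzag_poly p m"

lemma Omega_0: "Omega 0 = {[]}"
  by (auto simp: Omega_def)

lemma Omega_1: "Omega (Suc 0) = {[0], [1]}"
  by (auto simp: Omega_def length_Suc_conv)

text \<open>Complementing reverses every inequality and prefixing an entry shifts the parity of
  positions, so the two effects cancel; the new first inequality holds because 1 is maximal.\<close>

lemma Omega_Cons_complement:
  "1 # map (\<lambda>x. 1 - x) v \<in> Omega (Suc n) \<longleftrightarrow> v \<in> Omega n"
proof -
  let ?w = "1 # map (\<lambda>x. 1 - x) v"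
  let ?ok = "\<lambda>u k. if even k then u ! k \<ge> (u ! Suc k :: int) else u ! k \<le> u ! Suc k"
  have set: "set ?w \<subseteq> {0, 1} \<longleftrightarrow> set v \<subseteq> {0, 1}"
    by (auto simp: subset_iff)
  have "(\<forall>k. Suc k < Suc n \<longrightarrow> ?ok ?w k) \<longleftrightarrow> (\<forall>k. Suc k < n \<longrightarrow> ?ok v k)"
    if v: "length v = n" "set v \<subseteq> {0, 1}"
  proof -
    have Suc: "?ok ?w (Suc k) \<longleftrightarrow> ?ok v k" if "Suc k < n" for k
      using that v by simp
    have "?ok ?w 0" if "n > 0"
      using that v nth_mem[of 0 v] by fastforce
    hence "?ok ?w k" if "\<forall>k. Suc k < n \<longrightarrow> ?ok v k" "Suc k < Suc n" for k
      using that Suc[of "k - 1"] by (cases k) auto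
    thus ?thesis using Suc by blast
  qed
  thus ?thesis unfolding Omega_def mem_Collect_eq set by (metis length_Cons length_map nat.inject)
qed

lemma Omega_Suc_Suc:
  "Omega (Suc (Suc n)) = (\<lambda>v. 0 # 0 # v) ` Omega n \<union> (\<lambda>v. 1 # map (\<lambda>x. 1 - x) v) ` Omega (Suc n)"
    (is "_ = ?A \<union> ?B")
proof (intro equalityI subsetI)
  fix e assume e: "e \<in> Omega (Suc (Suc n))"
  then obtain a c v where acv: "e = a # c # v"
    by (auto simp: Omega_def length_Suc_conv)
  have v: "v \<in> Omega n" and ac: "(a, c) \<in> {(0,0), (1,0), (1,1)}"
    using Omega_Cons_Cons e unfolding acv by blast+
  show "e \<in> ?A \<union> ?B"
  proof (cases "a = 0")
    case True
    thus ?thesis using ac v acv by auto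
  next
    case False
    \<comment> \<open>Complementing is an involution, so \<open>w\<close> is the only possible
      preimage.\<close>
    define w where "w = map (\<lambda>x. 1 - x) (c # v)"
    have "e = 1 # map (\<lambda>x. 1 - x) w"
      using False ac acv by (auto simp: w_def comp_def)
    thus ?thesis using e Omega_Cons_complement[of w "Suc n"] by blast
  qed
next
  fix e assume "e \<in> ?A \<union> ?B"
  thus "e \<in> Omega (Suc (Suc n))"
  proof
    assume "e \<in> ?A"
    then obtain v where v: "v \<in> Omega n" "e = 0 # 0 # v" by blast
    have "if even k then e ! k \<ge> e ! Suc k else e ! k \<le> e ! Suc k" if "Suc k < Suc (Suc n)" for k
    proof -
      consider "k = 0" | "k = 1" | j where "k = Suc (Suc j)"
        by (metis One_nat_def not0_implies_Suc)
      thus ?thesis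
      proof cases
        case 2
        have "v ! 0 \<ge> 0" using v that 2 nth_mem[of 0 v] unfolding Omega_def by fastforce
        thus ?thesis using 2 v by simp
      next
        case 3
        have "if even j then v ! j \<ge> v ! Suc j else v ! j \<le> v ! Suc j"
          using v that 3 unfolding Omega_def by fastforce
        thus ?thesis using v 3 by simp
      qed (use v in auto)
    qed
    thus ?thesis using v unfolding Omega_def by fastforce
  qed (auto simp: Omega_Cons_complement)
qed

lemma finite_Omega: "finite (Omega n)"
  by (rule finite_subset[OF _ finite_lists_length_eq[of "{0, 1}" n]]) (auto simp: Omega_def)

lemma seq_value_complement:
  "seq_value b (map (\<lambda>x. 1 - x) v) = (\<Sum>i<length v. b ^ i) - seq_value b v"
proof (induction v)
  case Nil
  show ?case by (simp add: seq_value_def)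
next
  case (Cons a v)
  thus ?case by (simp add: seq_value_Cons algebra_simps)
qed

text \<open>The index is shifted by 2 so that \<open>zigzag_poly p m\<close> corresponds to the
  bracket [0,m].\<close>

lemma sum_Omega_eq_zigzag_poly:
  assumes p: "p \<ge> 1"
  shows "(\<Sum>e\<in>Omega n. monom (1 :: 'a :: comm_ring_1) (nat ((-1) ^ Suc n * seq_value (- int p) e)))
          = zigzag_poly p (n + 2)"
proof (induction n rule: induct_nat_012)
  case 0
  show ?case by (simp add: Omega_0 seq_value_def monom_eq_1)
next
  case 1
  show ?case by (simp add: Omega_1 seq_value_def monom_eq_1 eval_nat_numeral zigzag_exp.simps)
next
  case (ge2 n)
  define E where "E = (\<lambda>n e. nat ((-1) ^ Suc n * seq_value (- int p) e))"
  let ?f = "\<lambda>v :: int list. 0 # 0 # v" and ?g = "\<lambda>v :: int list. 1 # map (\<lambda>x. 1 - x) v"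
  have f: "E (Suc (Suc n)) (?f v) = E n v" for v
    by (simp add: E_def seq_value_Cons)
  \<comment> \<open>The leading 1 completes the all-ones sum left by complementing; the minus sign
    before the value of \<open>v\<close> is absorbed by the sign change from n+2 to n+1.\<close>
  have g: "E (Suc (Suc n)) (?g v) = zigzag_exp p (Suc (Suc n)) + E (Suc n) v" if "v \<in> Omega (Suc n)" for v
  proof -
    have len: "length v = Suc n" using that by (simp add: Omega_def)
    have "(-1) ^ Suc (Suc (Suc n)) * seq_value (- int p) (?g v) =
          int (zigzag_exp p (Suc (Suc n))) + (-1) ^ Suc (Suc n) * seq_value (- int p) v"
      unfolding int_zigzag_exp_Suc[OF p] seq_value_Cons seq_value_complement length_map len
      by (simp add: algebra_simps flip: lessThan_Suc_atMost)
    thus ?thesis using exponent_nonneg[OF that p] by (simp add: E_def nat_add_distrib)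
  qed
  have injg: "inj_on ?g (Omega (Suc n))" and injf: "inj_on ?f (Omega n)"
    by (auto simp: inj_on_def intro!: list.inj_map_strong[of _ _ "\<lambda>x. 1 - x" "\<lambda>x. 1 - x"])
  have "(\<Sum>e\<in>Omega (Suc (Suc n)). monom (1 :: 'a) (E (Suc (Suc n)) e)) =
        (\<Sum>e\<in>?f ` Omega n. monom 1 (E (Suc (Suc n)) e)) +
        (\<Sum>e\<in>?g ` Omega (Suc n). monom 1 (E (Suc (Suc n)) e))"
    unfolding Omega_Suc_Suc by (rule sum.union_disjoint) (auto simp: finite_Omega)
  also have "(\<Sum>e\<in>?f ` Omega n. monom (1 :: 'a) (E (Suc (Suc n)) e)) = (\<Sum>e\<in>Omega n. monom 1 (E n e))"
    by (simp only: sum.reindex[OF injf] comp_def f)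
  also have "(\<Sum>e\<in>?g ` Omega (Suc n). monom (1 :: 'a) (E (Suc (Suc n)) e)) =
      monom 1 (zigzag_exp p (Suc (Suc n))) * (\<Sum>e\<in>Omega (Suc n). monom 1 (E (Suc n) e))"
    unfolding sum.reindex[OF injg] comp_def sum_distrib_left
    by (intro sum.cong refl) (simp only: g mult_monom mult_1)
  finally show ?case
    using ge2.IH unfolding E_def by (simp add: add.commute)
qed

section \<open>Monicity and simple roots\<close>

lemma lead_coeff_zigzag_poly:
  assumes "p > 1"
  shows "lead_coeff (zigzag_poly p (Suc m) :: 'a :: idom poly) = 1"
proof -
  let ?H = "zigzag_poly p :: nat \<Rightarrow> 'a poly"
  \<comment> \<open>Monotone degrees are carried along so that the product term, multiplied by a
    positive power of X, dominates the older term.\<close>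
  have "lead_coeff (?H (Suc m)) = 1 \<and> degree (?H m) \<le> degree (?H (Suc m)) \<and>
    lead_coeff (?H (Suc (Suc m))) = 1 \<and> degree (?H (Suc m)) \<le> degree (?H (Suc (Suc m)))"
  proof (induction m)
    case 0
    show ?case by (simp add: monom_eq_1)
  next
    case (Suc m)
    let ?M = "monom 1 (zigzag_exp p (Suc m)) * ?H (Suc (Suc m))"
    have "?H (Suc (Suc m)) \<noteq> 0" using Suc.IH by (metis leading_coeff_0_iff zero_neq_one)
    hence "degree ?M = zigzag_exp p (Suc m) + degree (?H (Suc (Suc m)))"
      by (subst degree_mult_eq) (auto simp: degree_monom_eq)
    moreover have "zigzag_exp p (Suc m) > 0" using assms by (rule zigzag_exp_pos)
    ultimately have lt: "degree (?H (Suc m)) < degree ?M"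
      and le: "degree (?H (Suc (Suc m))) \<le> degree ?M" using Suc.IH by linarith+
    have "lead_coeff ?M = 1" using Suc.IH by (simp add: lead_coeff_mult degree_monom_eq)
    with lt have "lead_coeff (?M + ?H (Suc m)) = 1"
      by (simp only: lead_coeff_add_le add.commute)
    moreover have "degree (?M + ?H (Suc m)) = degree ?M" using lt by (rule degree_add_eq_left)
    ultimately show ?case using Suc.IH le by (simp only: zigzag_poly.simps(3))
  qed
  thus ?thesis by blast
qed

lemma poly_zigzag_poly_0:
  assumes "p > 1"
  shows "poly (zigzag_poly p (Suc m) :: 'a :: idom poly) 0 = 1"
  using assms
proof (induction m rule: induct_nat_012)
  case (ge2 n)
  thus ?case using zigzag_exp_pos[of p n] by (simp add: poly_monom)
qed (auto simp: monom_eq_1)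

text \<open>As in Euclid's algorithm, a common root descends through the recurrence to the constant
  1 at index 1.\<close>

lemma zigzag_poly_no_common_root:
  assumes "p > 1" and "poly (zigzag_poly p m :: 'a :: idom poly) z = 0"
  shows "poly (zigzag_poly p (Suc m)) z \<noteq> 0"
proof
  assume "poly (zigzag_poly p (Suc m)) z = 0"
  with assms(2) show False
  proof (induction m)
    case (Suc m)
    have "z \<noteq> 0" using Suc.prems(1) poly_zigzag_poly_0[OF assms(1), of m] by (metis zero_neq_one)
    with Suc.prems have "poly (zigzag_poly p m) z = 0" by simp
    with Suc.prems(1) show False using Suc.IH by blast
  qed simp
qed

lemma pderiv_zigzag_poly:
  fixes p :: nat
  assumes p: "prime p" and char: "CHAR('a :: idom) = p"
  shows "pderiv (zigzag_poly p (2 * k + 1) :: 'a poly) = zigzag_poly p (2 * k) ^ p"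
    and "pderiv (monom 1 1 * zigzag_poly p (2 * k + 2) :: 'a poly) = zigzag_poly p (2 * k + 1) ^ p"
proof -
  let ?H = "zigzag_poly p :: nat \<Rightarrow> 'a poly"
  have p1: "p \<ge> 1" using p by (rule prime_ge_1_nat)
  have frob: "(a + b) ^ p = a ^ p + b ^ p" for a b :: "'a poly"
    by (rule freshmans_dream) (simp_all add: p char)
  have of_nat_p: "of_nat p = (0 :: 'a)" using char of_nat_CHAR by metis
  have monom_p: "monom 1 (p * n) = (monom 1 n :: 'a poly) ^ p" for n
    by (simp add: monom_power mult.commute)
  have pderiv_p: "pderiv (monom 1 (p * n) * q) = monom 1 (p * n) * pderiv (q :: 'a poly)" for n q
    by (simp add: pderiv_mult pderiv_monom of_nat_p)
  \<comment> \<open>Differentiating the recurrence yields the \<open>p\<close>-th power of the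
    recurrence one index lower.\<close>
  have step: "pderiv (monom 1 (p * n) * q + r) = (monom 1 n * u + v) ^ p"
    if "pderiv q = u ^ p" "pderiv r = v ^ p" for n and q r u v :: "'a poly"
    unfolding pderiv_add pderiv_p that frob power_mult_distrib by (simp only: monom_p)
  have "pderiv (?H (2 * k + 1)) = ?H (2 * k) ^ p \<and>
        pderiv (monom 1 1 * ?H (2 * k + 2)) = ?H (2 * k + 1) ^ p"
  proof (induction k)
    case 0
    show ?case using p1 by (simp add: pderiv_monom power_0_left monom_eq_1)
  next
    case (Suc k)
    have H3: "?H (2 * k + 3) = monom 1 (p * zigzag_exp p (2 * k)) * (monom 1 1 * ?H (2 * k + 2)) + ?H (2 * k + 1)"
      using zigzag_exp_parity(1)[OF p1, of k]
      by (simp add: eval_nat_numeral mult_monom flip: mult.assoc)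
    have 1: "pderiv (?H (2 * k + 3)) = ?H (2 * k + 2) ^ p"
      unfolding H3 using step Suc.IH by simp
    have "monom 1 1 * ?H (2 * k + 4) =
        monom 1 (zigzag_exp p (2 * k + 2) + 1) * ?H (2 * k + 3) + monom 1 1 * ?H (2 * k + 2)"
      by (simp add: eval_nat_numeral mult_monom distrib_left flip: mult.assoc)
    also note zigzag_exp_parity(2)[OF p1, of k]
    finally have 2: "pderiv (monom 1 1 * ?H (2 * k + 4)) =
        (monom 1 (zigzag_exp p (2 * k + 1)) * ?H (2 * k + 2) + ?H (2 * k + 1)) ^ p"
      using step[OF 1 conjunct2[OF Suc.IH]] by simp
    show ?case using 1 2 by (simp add: eval_nat_numeral)
  qed
  thus "pderiv (?H (2 * k + 1)) = ?H (2 * k) ^ p"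
       "pderiv (monom 1 1 * ?H (2 * k + 2)) = ?H (2 * k + 1) ^ p" by auto
qed

lemma zigzag_poly_simple_roots:
  fixes p :: nat and z :: "'a :: idom"
  assumes p: "prime p" and char: "CHAR('a) = p" and root: "poly (zigzag_poly p (Suc m)) z = 0"
  shows "poly (pderiv (zigzag_poly p (Suc m))) z \<noteq> 0"
proof
  assume d: "poly (pderiv (zigzag_poly p (Suc m))) z = 0"
  have p1: "p > 1" using p by (rule prime_gt_1_nat)
  have "poly (zigzag_poly p m) z ^ p = 0"
  proof (cases "even m")
    case True
    then obtain k where "m = 2 * k" by blast
    thus ?thesis using d pderiv_zigzag_poly(1)[OF p char, of k] by (simp add: poly_power)
  next
    case False
    then obtain k where k: "m = 2 * k + 1" by (elim oddE)
    have "poly (pderiv (monom 1 1 * zigzag_poly p (Suc m))) z = 0"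
      using d root by (simp add: pderiv_mult)
    thus ?thesis using pderiv_zigzag_poly(2)[OF p char, of k] k by (simp add: poly_power)
  qed
  thus False using zigzag_poly_no_common_root[OF p1] root by auto
qed

text \<open>A repeated linear factor would also be a factor of the derivative, so the multiset of
  roots is a set.\<close>

lemma alg_closed_monic_eq_prod_roots:
  fixes q :: "'a :: alg_closed_field poly"
  assumes monic: "lead_coeff q = 1" and simple: "\<And>z. poly q z = 0 \<Longrightarrow> poly (pderiv q) z \<noteq> 0"
  shows "q = (\<Prod>z | poly q z = 0. [:- z, 1:])"
proof -
  have "q \<noteq> 0" using monic by auto
  obtain A where A: "q = (\<Prod>x\<in>#A. [:-x, 1:])"
    using alg_closed_imp_factorization[OF \<open>q \<noteq> 0\<close>] monic by auto
  have le1: "count A x \<le> 1" for x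
  proof (rule ccontr)
    assume "\<not> count A x \<le> 1"
    hence "{#x, x#} \<subseteq># A" by (auto simp: subseteq_mset_def)
    then obtain B where B: "A = {#x, x#} + B" by (auto simp: subset_mset.le_iff_add)
    have q: "q = [:-x, 1:] * ([:-x, 1:] * (\<Prod>x\<in>#B. [:-x, 1:]))"
      by (subst A) (simp add: B)
    have "poly q x = 0" by (subst q) simp
    moreover have "poly (pderiv q) x = 0"
      by (subst q, simp only: pderiv_mult) (simp add: pderiv_pCons)
    ultimately show False using simple by blast
  qed
  have "count A x = count (mset_set (set_mset A)) x" for x
  proof (cases "x \<in># A")
    case True
    hence "count A x = 1" using le1[of x] by (intro le_antisym) simp_all
    thus ?thesis using True by simp
  qed (simp add: not_in_iff)
  hence "A = mset_set (set_mset A)" by (intro multiset_eqI)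
  moreover have "set_mset A = {z. poly q z = 0}"
    by (auto simp: A poly_prod_mset prod_mset_zero_iff)
  ultimately have "A = mset_set {z. poly q z = 0}" by simp
  thus ?thesis by (subst A) (simp add: prod_unfold_prod_mset)
qed

section \<open>Frobenius, brackets and the recurrence for [0,m]\<close>

lemma frob_diff:
  fixes x y :: "'a :: comm_ring_1"
  assumes "prime p" "CHAR('a) = p"
  shows "(x - y) ^ (p ^ n) = x ^ (p ^ n) - y ^ (p ^ n)"
  using freshmans_dream'[of "p ^ n" n "x - y" y] assms by (simp add: eq_diff_eq)

lemma bracket_frob:
  fixes x y :: "'a :: field"
  assumes "prime p" "CHAR('a) = p"
  shows "bracket p x y i j ^ (p ^ n) = bracket p x y (i + n) (j + n)"
  by (simp add: bracket_def frob_diff[OF assms] power_mult_distrib power_add flip: power_mult)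

text \<open>The relation between the 2x2 minors of the matrix with columns indexed by 0, m, m+1,
  m+2. Brackets of neighbouring indices are Frobenius powers of [0,1] and [0,2].\<close>

lemma bracket_pluecker:
  "bracket p x y 0 (m + 2) * bracket p x y m (m + 1) =
   bracket p x y 0 (m + 1) * bracket p x y m (m + 2) - bracket p x y 0 m * bracket p x y (m + 1) (m + 2)"
  unfolding bracket_def by algebra

lemma nu_altdef:
  fixes x y :: "'a :: field"
  assumes "prime p" "CHAR('a) = p"
  shows "nu p x y = - (bracket p x y 0 2 ^ (p + 1) / bracket p x y 0 1 ^ (p ^ 2 + 1))"
  using bracket_frob[OF assms, of x y 0 2 1] bracket_frob[OF assms, of x y 0 1 2]
  by (simp add: nu_def numeral_2_eq_2 numeral_3_eq_3)

text \<open>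
  The brackets \<open>[0,m]\<close> and the values of \<open>zigzag_poly\<close> at \<open>\<nu>\<close> satisfy three-term recurrences that
  agree after rescaling; the last conjunct of the induction is the compatibility of the scaling
  factors of two consecutive terms.
\<close>

lemma zigzag_poly_nu:
  fixes x y :: "'a :: field"
  assumes p: "prime p" and char: "CHAR('a) = p" and nz: "nu p x y \<noteq> 0"
  shows "poly (zigzag_poly p m) (nu p x y) = 0 \<longleftrightarrow> bracket p x y 0 m = 0"
proof -
  define D A z where "D = bracket p x y 0 1" and "A = bracket p x y 0 2" and "z = nu p x y"
  define h where "h = (\<lambda>m. poly (zigzag_poly p m) z)"
  define b where "b = bracket p x y 0"
  have p1: "p \<ge> 1" using p by (rule prime_ge_1_nat)
  \<comment> \<open>Division by zero gives 0, so a nonzero value of \<open>nu\<close> also excludes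
    \<open>D = 0\<close>.\<close>
  have DA: "D \<noteq> 0" "A \<noteq> 0" using nz p by (auto simp: nu_altdef[OF p char] D_def A_def)
  have z: "z \<noteq> 0" using nz by (simp add: z_def)
  have zpow: "z ^ (p ^ m) * D ^ (p ^ m) * D ^ (p ^ (m + 2)) = - (A ^ (p ^ m) * A ^ (p ^ (m + 1)))" for m
  proof -
    have "z ^ (p ^ m) = - ((A ^ (p + 1) / D ^ (p ^ 2 + 1)) ^ (p ^ m))"
      using frob_diff[OF p char, of 0 "A ^ (p + 1) / D ^ (p ^ 2 + 1)" m] p1
      by (simp add: z_def nu_altdef[OF p char] A_def D_def)
    thus ?thesis using DA
      by (simp add: power_divide field_simps power_add power_mult_distrib power2_eq_square flip: power_mult)
  qed
  have frob: "b 1 ^ (p ^ n) = bracket p x y n (n + 1)" "b 2 ^ (p ^ n) = bracket p x y n (n + 2)" for n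
    using bracket_frob[OF p char, of x y 0 _ n] by (simp_all add: b_def add.commute)
  have rec: "b (m + 2) * D ^ (p ^ m) = b (m + 1) * A ^ (p ^ m) - b m * D ^ (p ^ (m + 1))" for m
    using bracket_pluecker[of p x y m] frob[of m] frob(1)[of "m + 1"]
    by (simp add: b_def D_def A_def add.assoc)
  have "\<exists>c c'. c \<noteq> 0 \<and> c' \<noteq> 0 \<and> h m = c * b m \<and> h (m + 1) = c' * b (m + 1) \<and>
      z ^ zigzag_exp p m * c' * D ^ (p ^ (m + 1)) = - (c * A ^ (p ^ m))" for m
  proof (induction m)
    case 0
    show ?case
      \<comment> \<open>The values at index 1 force \<open>c' = 1 / D\<close>; at index 0 both sides
        vanish, so \<open>c\<close> is read off from the compatibility condition.\<close>
      by (rule exI[of _ "- (D ^ p / (D * A))"], rule exI[of _ "1 / D"])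
         (use DA in \<open>simp add: h_def b_def bracket_def, simp add: D_def bracket_def\<close>)
  next
    case (Suc m)
    then obtain c c' where c: "c \<noteq> 0" "c' \<noteq> 0" "h m = c * b m" "h (m + 1) = c' * b (m + 1)"
      and cc: "z ^ zigzag_exp p m * c' * D ^ (p ^ (m + 1)) = - (c * A ^ (p ^ m))" by blast
    \<comment> \<open>Found by comparing the coefficients of \<open>b m\<close> in the two
      recurrences.\<close>
    define c'' where "c'' = - (c * D ^ (p ^ m) / D ^ (p ^ (m + 1)))"
    define P Q R S T where "P = D ^ (p ^ m)" and "Q = D ^ (p ^ (m + 1))" and "R = D ^ (p ^ (m + 2))"
      and "S = A ^ (p ^ m)" and "T = A ^ (p ^ (m + 1))"
    define u v where "u = z ^ zigzag_exp p m" and "v = z ^ zigzag_exp p (Suc m)"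
    note defs = P_def Q_def R_def S_def T_def u_def v_def
    have nz: "u \<noteq> 0" "Q \<noteq> 0" using z DA by (simp_all add: defs)
    have c'': "c'' * Q = - (c * P)" using DA by (simp add: c''_def defs)
    have cc': "u * c' * Q = - (c * S)" using cc by (simp add: defs)
    have "u * v = z ^ (p ^ m)"
      by (simp add: defs flip: power_add zigzag_exp_add[OF p1, of m])
    with zpow[of m] have uv: "u * v * P * R = - (S * T)" by (simp add: defs)
    have rec': "b (m + 2) * P = b (m + 1) * S - b m * Q" using rec[of m] by (simp add: defs)
    have h: "h (m + 2) = u * h (m + 1) + h m"
      by (simp add: h_def u_def poly_monom)
    have "h (m + 2) * Q = c'' * b (m + 2) * Q"
      unfolding h c using cc' c'' rec' by algebra
    hence h2: "h (m + 2) = c'' * b (m + 2)" using nz by simp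
    \<comment> \<open>Multiplying by \<open>u * Q\<close> produces \<open>u * v\<close>, the full
      power of \<open>z\<close> known from \<open>zpow\<close>.\<close>
    have "u * Q * (v * c'' * R) = u * Q * (- (c' * T))"
      using cc' c'' uv by algebra
    hence "v * c'' * R = - (c' * T)"
      by (rule mult_left_cancel[THEN iffD1, rotated]) (use nz in simp)
    moreover have "c'' \<noteq> 0" using c DA by (simp add: c''_def)
    ultimately show ?case using c h2
      by (intro exI[of _ c'] exI[of _ c'']) (simp add: defs)
  qed
  from this[of m] show ?thesis by (auto simp: h_def b_def z_def)
qed

section \<open>Linear independence and preimages under \<open>nu\<close>\<close>

lemma Ints_frob:
  assumes "prime p" "CHAR('a :: field) = p" "(a :: 'a) \<in> \<int>"
  shows "a ^ p = a"
proof -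
  have "of_int k \<in> (GF p 1 :: 'a set)" for k
    by (induction k rule: int_induct[where k = 0]) (auto simp: GF_subfield[OF assms(1,2)])
  thus ?thesis using assms(3) by (auto simp: GF_def elim!: Ints_cases)
qed

text \<open>A relation over the prime field and its Frobenius image form a linear system with
  determinant [0,1].\<close>

lemma lin_indep_FpI:
  fixes x y :: "'a :: field"
  assumes p: "prime p" "CHAR('a) = p" and nz: "bracket p x y 0 1 \<noteq> 0"
  shows "lin_indep_Fp x y"
  unfolding lin_indep_Fp_def
proof (intro ballI impI)
  fix a b :: 'a assume ab: "a \<in> \<int>" "b \<in> \<int>" "a * x + b * y = 0"
  have "(a * x + b * y) ^ p = (a * x) ^ p + (b * y) ^ p"
    by (rule freshmans_dream) (simp_all add: p)
  also have "\<dots> = a * x ^ p + b * y ^ p"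
    using ab by (simp add: power_mult_distrib Ints_frob[OF p])
  finally have 2: "a * x ^ p + b * y ^ p = 0" using ab(3) prime_gt_0_nat[OF p(1)] by (simp add: power_0_left)
  have "a * (x * Y - X * y) = 0" "b * (x * Y - X * y) = 0" if "a * X + b * Y = 0" for X Y
    using ab(3) that by algebra+
  from this[OF 2] have "a * bracket p x y 0 1 = 0" "b * bracket p x y 0 1 = 0"
    by (simp_all add: bracket_def)
  thus "a = 0 \<and> b = 0" using nz by simp
qed

text \<open>
  With \<open>s = t - t\<^sup>p\<close> and \<open>w = s\<^bsup>p-1\<^esup>\<close> one has \<open>\<nu>(t,1) = -(1 + w)\<^bsup>p+1\<^esup> / w\<^sup>p\<close>, so a preimage of \<open>z\<close> is
  found by solving for \<open>w\<close>, \<open>s\<close> and \<open>t\<close> in turn.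
\<close>

lemma nu_surj:
  fixes z :: "'a :: alg_closed_field"
  assumes p: "prime p" and char: "CHAR('a) = p" and z: "z \<noteq> 0"
  obtains t where "nu p t 1 = z" "bracket p t 1 0 1 \<noteq> 0"
proof -
  have p1: "p > 1" using p by (rule prime_gt_1_nat)
  have "degree ([:1, 1:] ^ (p + 1) + monom z p) = p + 1"
    by (subst degree_add_eq_left) (simp_all add: degree_linear_power degree_monom_eq z del: power_Suc)
  then obtain w where "poly ([:1, 1:] ^ (p + 1) + monom z p) w = 0"
    using alg_closed_imp_poly_has_root by (metis add_gr_0 zero_less_one)
  hence w: "(1 + w) ^ (p + 1) + z * w ^ p = 0" by (simp add: poly_power poly_monom distrib_right)
  \<comment> \<open>At 0 the equation for \<open>w\<close> would read 1 = 0.\<close>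
  have w0: "w \<noteq> 0" using w p1 by (auto simp: power_0_left)
  obtain s where s: "s ^ (p - 1) = w" using nth_root_exists[of "p - 1" w] p1 by auto
  have s0: "s \<noteq> 0" using s w0 p1 by (auto simp: power_0_left)
  have "degree ([:s, -1:] + monom 1 p) = p"
    using p1 by (subst degree_add_eq_right) (auto simp: degree_monom_eq)
  then obtain t where "poly ([:s, -1:] + monom 1 p) t = 0"
    using alg_closed_imp_poly_has_root p1 by (metis less_trans zero_less_one)
  hence t: "t - t ^ p = s" by (simp add: poly_monom algebra_simps)
  have b1: "bracket p t 1 0 1 = s" by (simp add: bracket_def t)
  \<comment> \<open>Adding \<open>s\<close> and its Frobenius image telescopes.\<close>
  have "s + s ^ p = t - t ^ (p ^ 2)"
    using frob_diff[OF p char, of t "t ^ p" 1] by (simp add: power2_eq_square flip: t power_mult)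
  moreover have sp: "s ^ p = s * w" using s p1 by (metis power_minus_mult mult.commute zero_less_one less_trans)
  ultimately have b2: "bracket p t 1 0 2 = s * (1 + w)" by (simp add: bracket_def distrib_left)
  have "s ^ (p ^ 2) = s * w * w ^ p"
    unfolding power2_eq_square power_mult sp power_mult_distrib by simp
  hence "s ^ (p ^ 2 + 1) = s * (s * w) * w ^ p"
    by (simp add: mult_ac)
  moreover have "(s * (1 + w)) ^ (p + 1) = s * (s * w) * (1 + w) ^ (p + 1)"
    by (simp add: power_mult_distrib sp mult_ac)
  ultimately have "nu p t 1 = - (s * (s * w) * (1 + w) ^ (p + 1) / (s * (s * w) * w ^ p))"
    unfolding nu_altdef[OF p char] b1 b2 by (simp only:)
  also have "\<dots> = - ((1 + w) ^ (p + 1) / w ^ p)" using s0 w0 by simp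
  also have "\<dots> = z" using w w0 by (simp add: field_simps add_eq_0_iff)
  finally show ?thesis using that b1 s0 by blast
qed

section \<open>Roots as values of \<open>nu\<close>, and the final identity\<close>

lemma Z_circ_eq_roots:
  assumes p: "prime p" and char: "CHAR('a :: alg_closed_field) = p"
  shows "(Z_circ p (Suc m) :: 'a set) = {z. poly (zigzag_poly p (Suc m)) z = 0}"
proof (intro equalityI subsetI)
  fix z :: 'a assume "z \<in> Z_circ p (Suc m)"
  then obtain x y where xy: "z = nu p x y" "nu p x y \<noteq> 0" "x \<in> GF p (Suc m)" "y \<in> GF p (Suc m)"
    by (auto simp: Z_circ_def Z_set_def)
  have "bracket p x y 0 (Suc m) = 0" using xy by (simp add: bracket_def GF_def)
  thus "z \<in> {z. poly (zigzag_poly p (Suc m)) z = 0}"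
    using zigzag_poly_nu[OF p char xy(2)] xy(1) by simp
next
  fix z :: 'a assume "z \<in> {z. poly (zigzag_poly p (Suc m)) z = 0}"
  hence root: "poly (zigzag_poly p (Suc m)) z = 0" by simp
  hence z: "z \<noteq> 0" using poly_zigzag_poly_0[OF prime_gt_1_nat[OF p], of m] by (metis zero_neq_one)
  obtain t where t: "nu p t 1 = z" "bracket p t 1 0 1 \<noteq> 0" using nu_surj[OF p char z] by blast
  \<comment> \<open>With second argument 1, vanishing of [0,m+1] is exactly the equation defining
    \<open>GF p (Suc m)\<close>.\<close>
  have "bracket p t 1 0 (Suc m) = 0"
    using zigzag_poly_nu[OF p char, of t 1 "Suc m"] root t z by simp
  hence "t \<in> GF p (Suc m)" by (simp add: bracket_def GF_def)
  moreover have "1 \<in> (GF p (Suc m) :: 'a set)" by (rule GF_subfield[OF p char])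
  ultimately show "z \<in> Z_circ p (Suc m)"
    using t z lin_indep_FpI[OF p char t(2)] by (auto simp: Z_circ_def Z_set_def)
qed

theorem theorem6p2:
  fixes p m :: nat
  assumes "prime p"
    and "is_alg_closure_Fp p TYPE('a :: alg_closed_field)"
    and "m \<ge> 2"
  shows "(f_poly p m :: 'a poly) =
    (\<Sum>\<epsilon>\<in>Omega (m - 2). monom 1 (nat ((-1) ^ (m - 1) * seq_value (- int p) \<epsilon>)))"
proof -
  have char: "CHAR('a) = p" using assms(2) by (simp add: is_alg_closure_Fp_def)
  obtain n where m: "m = n + 2" using assms(3) by (metis add.commute le_Suc_ex)
  have p1: "p > 1" using assms(1) by (rule prime_gt_1_nat)
  let ?H = "zigzag_poly p (Suc (Suc n)) :: 'a poly"
  have "f_poly p m = (\<Prod>z | poly ?H z = 0. [:- z, 1:])"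
    using Z_circ_eq_roots[OF assms(1) char, of "Suc n"] by (simp add: f_poly_def m)
  also have "\<dots> = ?H"
    by (rule alg_closed_monic_eq_prod_roots[symmetric])
       (use lead_coeff_zigzag_poly[OF p1] zigzag_poly_simple_roots[OF assms(1) char] in blast)+
  finally show ?thesis
    using sum_Omega_eq_zigzag_poly[of p n, where ?'a = 'a] p1 by (simp add: m)
qed

end
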